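(* Let $n\ge 2$, let $R_\alpha\in O(n-1)$ and let $\beta\in\mathbb{R}\setminus\{0\}$ be fixed. Let $\Gamma$ be a discrete subgroup of $O(n,1)$ generated by a matrix $A\in O(n,1)$ that is conjugate in $O(n,1)$ to the block matrix $$\mathcal{L}_{\alpha,\beta}=\begin{bmatrix} R_\alpha & 0\\ 0 & \mathcal{H}_\beta\end{bmatrix},$$ say $PAP^{-1}=\mathcal{L}_{\alpha,\beta}$ with $P\in O(n,1)$. Use the linear coordinates $(x_1,\dots,x_{n-1},x,y)=P\xi$, $\xi\in\mathbb{R}^{n,1}$, in which $A$ acts by $\mathcal{L}_{\alpha,\beta}$. Then the ring $\mathcal{P}_{\mathbb{R}^{n,1}}(\Gamma)$ of $\Gamma$-invariant real polynomials on $\mathbb{R}^{n,1}$ admits a Hilbert basis given by the union of a Hilbert basis $\{u_1,\dots,u_r\}$ of $\mathcal{P}_{\mathbb{R}^{n-1}}(\langle R_\alpha\rangle)$ (each $u_i$ being regarded as a polynomial in $x_1,\dots,x_{n-1}$) with the set $\{x^2-y^2\}$.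
   Context: $\mathbb{R}^{n,1}$ denotes $\mathbb{R}^{n+1}$ with the quadratic form $Q(x_1,\dots,x_n,y)=x_1^2+\cdots+x_n^2-y^2$, and $O(n,1)=\{A\in \mathrm{GL}(n+1,\mathbb{R}) : Q(A\xi)=Q(\xi)\text{ for all }\xi\in\mathbb{R}^{n+1}\}$, acting linearly on $\mathbb{R}^{n,1}$. $O(n-1)$ is the usual orthogonal group of $\mathbb{R}^{n-1}$. For $\beta\in\mathbb{R}$, $$\mathcal{H}_\beta=\begin{bmatrix}\cosh\beta&\sinh\beta\\ \sinh\beta&\cosh\beta\end{bmatrix}\in O(1,1).$$ For a group $G$ acting linearly on a finite-dimensional real vector space $V$, $\mathcal{P}_V(G)$ is the ring of real polynomial functions $f$ on $V$ with $f(gv)=f(v)$ for all $g\in G$, $v\in V$. A Hilbert basis of $\mathcal{P}_V(G)$ is a finite set of elements generating $\mathcal{P}_V(G)$ as an $\mathbb{R}$-algebra. $\langle R_\alpha\rangle$ is the cyclic subgroup of $O(n-1)$ generated by $R_\alpha$, acting on $\mathbb{R}^{n-1}$. *)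

theory Defs
  imports "HOL-Analysis.Analysis" "HOL-Algebra.Generated_Groups"
begin

text \<open>
  For a finite index type \<open>'m\<close>, put \<open>n = CARD('m) + 1\<close>, so \<open>n \<ge> 2\<close>.  Then \<open>real ^ 'm\<close> is the space of
  dimension \<open>n - 1\<close>, and \<open>real ^ ('m + 2)\<close> is the space of dimension \<open>n + 1\<close>, whose coordinates
  are \<open>x\<^sub>1, \<dots>, x\<^sub>n\<^sub>-\<^sub>1\<close> (indices \<open>Inl i\<close>), followed by \<open>x\<^sub>n\<close> (index \<open>Inr 1\<close>) and \<open>y\<close> (index \<open>Inr 2\<close>).
\<close>

definition lorentz_form :: "real ^ ('m::finite + 2) \<Rightarrow> real" where
  "lorentz_form \<xi> = (\<Sum>i\<in>UNIV. (\<xi> $ Inl i)\<^sup>2) + (\<xi> $ Inr 1)\<^sup>2 - (\<xi> $ Inr 2)\<^sup>2"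

definition GL_group :: "(real ^ 'k ^ 'k::finite) monoid" where
  "GL_group = \<lparr>carrier = {A. invertible A}, monoid.mult = (**), one = mat 1\<rparr>"

definition lorentz_group :: "(real ^ ('m::finite + 2) ^ ('m + 2)) monoid" where
  "lorentz_group = GL_group
     \<lparr>carrier := {A. invertible A \<and> (\<forall>\<xi>. lorentz_form (A *v \<xi>) = lorentz_form \<xi>)}\<rparr>"

definition orthogonal_group :: "(real ^ 'k ^ 'k::finite) monoid" where
  "orthogonal_group = GL_group \<lparr>carrier := {R. orthogonal_matrix R}\<rparr>"

definition hyperbolic_rotation :: "real \<Rightarrow> real ^ 2 ^ 2" where
  "hyperbolic_rotation \<beta> = vector [vector [cosh \<beta>, sinh \<beta>], vector [sinh \<beta>, cosh \<beta>]]"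

definition block_diag ::
  "real ^ 'k ^ 'k \<Rightarrow> real ^ 'l ^ 'l \<Rightarrow> real ^ ('k::finite + 'l::finite) ^ ('k + 'l)" where
  "block_diag B C = (\<chi> i j. case (i, j) of
       (Inl a, Inl b) \<Rightarrow> B $ a $ b
     | (Inr a, Inr b) \<Rightarrow> C $ a $ b
     | _ \<Rightarrow> 0)"

definition invariant_polynomials :: "(real ^ 'k ^ 'k::finite) set \<Rightarrow> (real ^ 'k \<Rightarrow> real) set" where
  "invariant_polynomials G =
     {f. real_polynomial_function f \<and> (\<forall>g\<in>G. \<forall>v. f (g *v v) = f v)}"

inductive_set subalgebra_generated :: "('v \<Rightarrow> real) set \<Rightarrow> ('v \<Rightarrow> real) set"
  for B :: "('v \<Rightarrow> real) set" where
  base: "f \<in> B \<Longrightarrow> f \<in> subalgebra_generated B"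
| const: "(\<lambda>v. c) \<in> subalgebra_generated B"
| add: "f \<in> subalgebra_generated B \<Longrightarrow> g \<in> subalgebra_generated B
    \<Longrightarrow> (\<lambda>v. f v + g v) \<in> subalgebra_generated B"
| mult: "f \<in> subalgebra_generated B \<Longrightarrow> g \<in> subalgebra_generated B
    \<Longrightarrow> (\<lambda>v. f v * g v) \<in> subalgebra_generated B"

definition hilbert_basis :: "('v \<Rightarrow> real) set \<Rightarrow> ('v \<Rightarrow> real) set \<Rightarrow> bool" where
  "hilbert_basis B \<A> \<longleftrightarrow> finite B \<and> B \<subseteq> \<A> \<and> subalgebra_generated B = \<A>"

lemma group_GL_group: "group (GL_group :: (real ^ 'k ^ 'k::finite) monoid)"
proof (rule groupI)
  fix A :: "real ^ 'k ^ 'k"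
  assume "A \<in> carrier GL_group"
  then show "\<exists>B\<in>carrier GL_group. B \<otimes>\<^bsub>GL_group\<^esub> A = \<one>\<^bsub>GL_group\<^esub>"
    by (auto simp: GL_group_def invertible_def)
qed (auto simp: GL_group_def invertible_mult matrix_mul_assoc invertible_def[of "mat 1"])

lemma subgroup_lorentz: "subgroup (carrier lorentz_group) GL_group"
proof (rule group.subgroupI[OF group_GL_group])
  fix A :: "real ^ ('m::finite + 2) ^ ('m + 2)"
  assume A: "A \<in> carrier lorentz_group"
  then have "invertible A" and Q: "\<And>\<xi>. lorentz_form (A *v \<xi>) = lorentz_form \<xi>"
    by (auto simp: lorentz_group_def)
  then obtain B where B: "A ** B = mat 1" "B ** A = mat 1"
    by (auto simp: invertible_def)
  have "inv\<^bsub>GL_group\<^esub> A = B"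
    using B by (intro group.inv_equality[OF group_GL_group]) (auto simp: GL_group_def invertible_def)
  moreover have "lorentz_form (B *v \<xi>) = lorentz_form \<xi>" for \<xi>
    using Q[of "B *v \<xi>"] B by (simp add: matrix_vector_mul_assoc)
  ultimately show "inv\<^bsub>GL_group\<^esub> A \<in> carrier lorentz_group"
    using B by (auto simp: lorentz_group_def invertible_def)
next
  show "carrier lorentz_group \<noteq> {}"
    by (auto simp: lorentz_group_def invertible_def intro!: exI[of _ "mat 1"])
next
  fix A B :: "real ^ ('m::finite + 2) ^ ('m + 2)"
  assume "A \<in> carrier lorentz_group" "B \<in> carrier lorentz_group"
  then show "A \<otimes>\<^bsub>GL_group\<^esub> B \<in> carrier lorentz_group"
    by (auto simp: lorentz_group_def GL_group_def invertible_mult matrix_vector_mul_assoc[symmetric])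
qed (auto simp: lorentz_group_def GL_group_def)

lemma group_lorentz_group: "group lorentz_group"
  using group.subgroup_imp_group[OF group_GL_group subgroup_lorentz]
  by (simp add: lorentz_group_def)

lemma subgroup_orthogonal: "subgroup (carrier orthogonal_group) GL_group"
proof (rule group.subgroupI[OF group_GL_group])
  fix A :: "real ^ 'k ^ 'k::finite"
  assume "A \<in> carrier orthogonal_group"
  then have A: "orthogonal_matrix A" by (simp add: orthogonal_group_def)
  then have "inv\<^bsub>GL_group\<^esub> A = transpose A"
    by (intro group.inv_equality[OF group_GL_group])
       (auto simp: GL_group_def invertible_def orthogonal_matrix_def)
  with A show "inv\<^bsub>GL_group\<^esub> A \<in> carrier orthogonal_group"
    by (simp add: orthogonal_group_def orthogonal_matrix_transpose)
next
  show "carrier orthogonal_group \<noteq> {}"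
    by (auto simp: orthogonal_group_def intro: orthogonal_matrix_id)
next
  fix A B :: "real ^ 'k ^ 'k::finite"
  assume "A \<in> carrier orthogonal_group" "B \<in> carrier orthogonal_group"
  then show "A \<otimes>\<^bsub>GL_group\<^esub> B \<in> carrier orthogonal_group"
    by (simp add: orthogonal_group_def GL_group_def orthogonal_matrix_mul)
qed (auto simp: orthogonal_group_def GL_group_def orthogonal_matrix_def invertible_def)

lemma group_orthogonal_group: "group orthogonal_group"
  using group.subgroup_imp_group[OF group_GL_group subgroup_orthogonal]
  by (simp add: orthogonal_group_def)

lemma block_diag_mult: "block_diag B C ** block_diag B' C' = block_diag (B ** B') (C ** C')"
  unfolding vec_eq_iff
proof (intro allI)
  fix i j
  show "(block_diag B C ** block_diag B' C') $ i $ j = block_diag (B ** B') (C ** C') $ i $ j"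
    by (cases i; cases j)
       (simp_all add: block_diag_def matrix_matrix_mult_def UNIV_Plus_UNIV[symmetric] sum.Plus
         del: UNIV_Plus_UNIV)
qed

lemma block_diag_one: "block_diag (mat 1) (mat 1) = mat 1"
  by (auto simp: vec_eq_iff block_diag_def mat_def split: sum.split)

lemma block_diag_vec:
  "(block_diag B C *v \<xi>) $ Inl i = (B *v (\<chi> i. \<xi> $ Inl i)) $ i"
  "(block_diag B C *v \<xi>) $ Inr j = (C *v (\<chi> i. \<xi> $ Inr i)) $ j"
  by (simp_all add: block_diag_def matrix_vector_mult_def UNIV_Plus_UNIV[symmetric] sum.Plus
        del: UNIV_Plus_UNIV)

lemma hyperbolic_rotation_inverse:
  "hyperbolic_rotation \<beta> ** hyperbolic_rotation (- \<beta>) = mat 1"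
  using hyperbolic_pythagoras[of \<beta>]
  by (simp add: hyperbolic_rotation_def vec_eq_iff forall_2 matrix_matrix_mult_def sum_2 mat_def
        power2_eq_square algebra_simps)

lemma block_diag_in_lorentz_group:
  assumes "R \<in> carrier orthogonal_group"
  shows "block_diag R (hyperbolic_rotation \<beta>) \<in> carrier lorentz_group"
proof -
  let ?H = "hyperbolic_rotation"
  have R: "orthogonal_matrix R" using assms by (simp add: orthogonal_group_def)
  have "block_diag R (?H \<beta>) ** block_diag (transpose R) (?H (- \<beta>)) = mat 1"
    using R by (simp add: block_diag_mult hyperbolic_rotation_inverse block_diag_one
        orthogonal_matrix_def)
  moreover have "block_diag (transpose R) (?H (- \<beta>)) ** block_diag R (?H \<beta>) = mat 1"
    using R hyperbolic_rotation_inverse[of "- \<beta>"]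
    by (simp add: block_diag_mult block_diag_one orthogonal_matrix_def)
  ultimately have "invertible (block_diag R (?H \<beta>))"
    by (auto simp: invertible_def)
  moreover have "lorentz_form (block_diag R (?H \<beta>) *v \<xi>) = lorentz_form \<xi>" for \<xi>
  proof -
    let ?x = "\<chi> i. \<xi> $ Inl i"
    have "norm (R *v ?x) = norm ?x"
      using R orthogonal_transformation_matrix[of "(*v) R"]
      by (simp add: orthogonal_transformation_norm)
    then have "(R *v ?x) \<bullet> (R *v ?x) = ?x \<bullet> ?x"
      by (simp add: norm_eq)
    then have "(\<Sum>i\<in>UNIV. ((R *v ?x) $ i)\<^sup>2) = (\<Sum>i\<in>UNIV. (\<xi> $ Inl i)\<^sup>2)"
      by (simp add: inner_vec_def power2_eq_square)
    moreover have "(cosh \<beta> * a + sinh \<beta> * b)\<^sup>2 - (sinh \<beta> * a + cosh \<beta> * b)\<^sup>2 = a\<^sup>2 - b\<^sup>2" for a b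
    proof -
      have "(cosh \<beta> * a + sinh \<beta> * b)\<^sup>2 - (sinh \<beta> * a + cosh \<beta> * b)\<^sup>2
        = ((cosh \<beta>)\<^sup>2 - (sinh \<beta>)\<^sup>2) * (a\<^sup>2 - b\<^sup>2)"
        by (simp add: power2_eq_square algebra_simps)
      then show ?thesis using hyperbolic_pythagoras[of \<beta>] by simp
    qed
    ultimately show ?thesis
      unfolding lorentz_form_def block_diag_vec
      by (simp add: hyperbolic_rotation_def matrix_vector_mult_def sum_2 add_diff_eq[symmetric])
  qed
  ultimately show ?thesis by (simp add: lorentz_group_def)
qed

end

theory Submission
  imports Defs "HOL-Computational_Algebra.Fundamental_Theorem_Algebra"
begin

text \<open>
  Since \<open>R\<close> preserves the norm, it is diagonalisable over the complex numbers, so every real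
  polynomial on \<open>real ^ 'm\<close> is a complex combination of monomials in linear eigenforms of \<open>R\<close>.
  The invariant ones only involve monomials of weight (eigenvalue) one, and by Dickson's lemma these
  monomials are products of finitely many of them; real and imaginary parts give a Hilbert basis.
  The block matrix has the additional eigenforms \<open>x + y\<close> and \<open>x - y\<close> with eigenvalues \<open>exp \<beta>\<close> and
  \<open>exp (- \<beta>)\<close>.  The eigenvalues of \<open>R\<close> have modulus one, so in a monomial of weight one these two
  forms occur with the same exponent, that is, only through \<open>x\<^sup>2 - y\<^sup>2\<close>.
\<close>

section \<open>Diagonalising an orthogonal transformation\<close>

text \<open>The polynomial \<open>p\<close> evaluated at the pullback of functions along
  \<open>T\<close>, applied to \<open>f\<close>. Acting on functions rather than on vectors covers
  linear forms and nonlinear monomials alike.\<close>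

definition poly_act :: "('v \<Rightarrow> 'v) \<Rightarrow> complex poly \<Rightarrow> ('v \<Rightarrow> complex) \<Rightarrow> 'v \<Rightarrow> complex" where
  "poly_act T p f v = (\<Sum>i\<le>degree p. coeff p i * f ((T ^^ i) v))"

lemma poly_act_bound:
  assumes "degree p \<le> n"
  shows "poly_act T p f v = (\<Sum>i\<le>n. coeff p i * f ((T ^^ i) v))"
  unfolding poly_act_def
  by (rule sum.mono_neutral_left) (use assms in \<open>auto simp: coeff_eq_0\<close>)

lemma poly_act_0 [simp]: "poly_act T 0 f v = 0"
  by (simp add: poly_act_def)

lemma poly_act_pCons [simp]: "poly_act T (pCons a p) f v = a * f v + poly_act T p f (T v)"
proof -
  have "poly_act T (pCons a p) f v = (\<Sum>i\<le>Suc (degree p). coeff (pCons a p) i * f ((T ^^ i) v))"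
    by (rule poly_act_bound) (simp add: degree_pCons_le)
  also have "\<dots> = a * f v + (\<Sum>i\<le>degree p. coeff p i * f ((T ^^ i) (T v)))"
    by (subst sum.atMost_Suc_shift) (simp add: funpow_swap1)
  finally show ?thesis by (simp add: poly_act_def)
qed

lemma poly_act_add: "poly_act T (p + q) f v = poly_act T p f v + poly_act T q f v"
  by (induction p q arbitrary: v rule: poly_induct2) (simp_all add: algebra_simps)

lemma poly_act_smult: "poly_act T (smult c p) f v = c * poly_act T p f v"
  by (induction p arbitrary: v) (simp_all add: algebra_simps)

lemma poly_act_mult: "poly_act T (p * q) f v = poly_act T p (poly_act T q f) v"
  by (induction p arbitrary: v) (simp_all add: poly_act_add poly_act_smult)

lemma poly_act_zero_fun: "poly_act T p (\<lambda>v. 0) v = 0"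
  by (simp add: poly_act_def)

lemma poly_act_add_fun:
  "poly_act T p (\<lambda>v. f v + g v) v = poly_act T p f v + poly_act T p g v"
  by (simp add: poly_act_def sum.distrib algebra_simps)

text \<open>Every power of the pullback fixes an invariant \<open>f\<close>, so \<open>p\<close>
  acts as the sum of its coefficients, which is its value at 1.\<close>

lemma poly_act_invariant:
  assumes "\<And>v. f (T v) = f v"
  shows "poly_act T p f v = poly p 1 * f v"
  by (induction p arbitrary: v) (simp_all add: assms algebra_simps)

section \<open>A polynomial annihilating each coordinate function\<close>

lemma exists_linear_relation:
  fixes w :: "nat \<Rightarrow> 'a::euclidean_space"
  shows "\<exists>c n. (\<exists>k\<le>n. c k \<noteq> 0) \<and> (\<Sum>k\<le>n. c k *\<^sub>R w k) = 0"
proof (cases "inj_on w {..DIM('a)}")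
  case True
  let ?S = "w ` {..DIM('a)}"
  have "card ?S = Suc DIM('a)" using True by (simp add: card_image)
  then have "dependent ?S" by (intro dependent_biggerset) auto
  then obtain u where u: "\<exists>v\<in>?S. u v \<noteq> 0" "(\<Sum>v\<in>?S. u v *\<^sub>R v) = 0"
    by (subst (asm) dependent_finite) auto
  from u(2) have "(\<Sum>k\<le>DIM('a). u (w k) *\<^sub>R w k) = 0"
    by (simp add: sum.reindex[OF True] o_def)
  with u(1) show ?thesis by (intro exI[of _ "\<lambda>k. u (w k)"] exI[of _ "DIM('a)"]) auto
next
  case False
  then obtain i j where ij: "i \<le> DIM('a)" "j \<le> DIM('a)" "i \<noteq> j" "w i = w j"
    by (auto simp: inj_on_def)
  \<comment> \<open>A repeated value is a relation by itself. It needs its own case because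
    \<open>dependent\<close> speaks of sets, where repetitions disappear.\<close>
  let ?c = "\<lambda>k. (if k = i then 1 else 0) - (if k = j then 1 else (0::real))"
  have "(\<Sum>k\<le>DIM('a). ?c k *\<^sub>R w k)
      = (\<Sum>k\<le>DIM('a). if k = i then w k else 0) - (\<Sum>k\<le>DIM('a). if k = j then w k else 0)"
    unfolding sum_subtractf[symmetric] by (rule sum.cong) auto
  also have "\<dots> = w i - w j"
    using ij(1,2) by (simp add: sum.delta)
  also have "\<dots> = 0"
    using ij(4) by simp
  finally have "(\<Sum>k\<le>DIM('a). ?c k *\<^sub>R w k) = 0" .
  moreover have "?c i \<noteq> 0" using ij(3) by simp
  ultimately show ?thesis using ij(1) by (intro exI[of _ ?c] exI[of _ "DIM('a)"] conjI exI[of _ i])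
qed

text \<open>Pulling back a coordinate functional repeatedly stays in a finite-dimensional dual
  space, so the iterates satisfy a nontrivial linear relation; its coefficients are those of
  \<open>p\<close>.\<close>

lemma exists_annihilating_poly:
  fixes R :: "real ^ 'm ^ 'm::finite"
  shows "\<exists>p. p \<noteq> 0 \<and> (\<forall>v. poly_act ((*v) R) p (\<lambda>v. of_real (v $ j)) v = 0)"
proof -
  \<comment> \<open>\<open>w k\<close> represents the functional sending \<open>v\<close> to
    coordinate \<open>j\<close> of its \<open>k\<close>-th iterate; it arises by iterating the
    transpose of \<open>R\<close>, written \<open>x v* R\<close>.\<close>
  define w where "w k = ((\<lambda>x. x v* R) ^^ k) (axis j 1)" for k
  have w: "(((*v) R) ^^ k) v $ j = v \<bullet> w k" for k v
  proof (induction k arbitrary: v)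
    case (Suc k)
    have "(((*v) R) ^^ Suc k) v $ j = (R *v v) \<bullet> w k"
      using Suc[of "R *v v"] by (simp add: funpow_swap1)
    also have "\<dots> = v \<bullet> w (Suc k)"
      by (simp add: w_def) (metis dot_lmul_matrix inner_commute)
    finally show ?case .
  qed (simp add: w_def inner_axis)
  obtain c :: "nat \<Rightarrow> real" and n where c: "\<exists>k\<le>n. c k \<noteq> 0" "(\<Sum>k\<le>n. c k *\<^sub>R w k) = 0"
    using exists_linear_relation[of w] by blast
  define p where "p = (\<Sum>k\<le>n. monom (complex_of_real (c k)) k)"
  have p: "coeff p i = (if i \<le> n then of_real (c i) else 0)" for i
    by (simp add: p_def coeff_sum sum.delta)
  have "degree p \<le> n" by (rule degree_le) (simp add: p)
  then have "poly_act ((*v) R) p (\<lambda>v. of_real (v $ j)) v = of_real (v \<bullet> (\<Sum>k\<le>n. c k *\<^sub>R w k))" for v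
    by (simp add: poly_act_bound[of p n] p w inner_sum_right)
  moreover have "p \<noteq> 0" using c(1) by (auto simp: poly_eq_iff p)
  ultimately show ?thesis using c(2) by auto
qed

section \<open>Bounded orbits and their eigenvalues\<close>

lemma continuous_bounded_on_sphere:
  fixes f :: "'a::euclidean_space \<Rightarrow> complex"
  assumes "continuous_on UNIV f"
  obtains C where "\<And>x. norm x = r \<Longrightarrow> norm (f x) \<le> C"
proof -
  have "compact (f ` sphere 0 r)"
    by (intro compact_continuous_image continuous_on_subset[OF assms]) auto
  then obtain C where "\<forall>y\<in>f ` sphere 0 r. norm y \<le> C"
    by (meson compact_imp_bounded bounded_iff)
  then show ?thesis by (intro that[of C]) auto
qed

lemma funpow_norm_preserving:
  fixes T :: "'a::real_normed_vector \<Rightarrow> 'a"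
  assumes "\<And>x. norm (T x) = norm x"
  shows "norm ((T ^^ n) x) = norm x"
  by (induction n) (simp_all add: assms)

text \<open>The orbit of \<open>x\<close> stays on a sphere, where \<open>f\<close> is bounded. Each
  forward step multiplies \<open>f\<close> by \<open>\<mu>\<close>, which excludes modulus above
  one; backward steps exclude modulus below one.\<close>

lemma eigenvalue_norm_1:
  fixes T :: "'a::euclidean_space \<Rightarrow> 'a" and f :: "'a \<Rightarrow> complex"
  assumes T: "orthogonal_transformation T" and cont: "continuous_on UNIV f"
    and ev: "\<And>v. f (T v) = \<mu> * f v" and nz: "f x \<noteq> 0"
  shows "norm \<mu> = 1"
proof -
  obtain C where C: "\<And>y. norm y = norm x \<Longrightarrow> norm (f y) \<le> C"
    using continuous_bounded_on_sphere[OF cont] by blast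
  have nT: "norm (T v) = norm v" for v using T by (simp add: orthogonal_transformation_norm)
  have pow: "f ((T ^^ n) v) = \<mu> ^ n * f v" for n v by (induction n) (simp_all add: ev)
  have "\<not> norm \<mu> > 1"
  proof
    assume "norm \<mu> > 1"
    then obtain n where "C / norm (f x) < norm \<mu> ^ n" using real_arch_pow by blast
    then have "C < norm (f ((T ^^ n) x))"
      using nz by (simp add: pow norm_mult norm_power divide_simps)
    then show False using C[of "(T ^^ n) x"] by (simp add: funpow_norm_preserving nT)
  qed
  moreover have "\<not> norm \<mu> < 1"
  proof
    assume lt: "norm \<mu> < 1"
    have C0: "C > 0" using C[of x] nz zero_less_norm_iff[of "f x"] by linarith
    then obtain n where n: "norm \<mu> ^ n < norm (f x) / C"
      using real_arch_pow_inv[OF _ lt, of "norm (f x) / C"] nz by auto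
    \<comment> \<open>A preimage \<open>y\<close> of \<open>x\<close> replaces the backward orbit.
      Bounding \<open>f x\<close> by a power of \<open>\<mu>\<close> times \<open>f y\<close> avoids
      dividing by \<open>\<mu>\<close>, which might still be zero here.\<close>
    have "surj (T ^^ n)"
      by (intro surj_fn orthogonal_transformation_surj T)
    then obtain y where y: "(T ^^ n) y = x" by (metis surjD)
    then have "norm y = norm x" using funpow_norm_preserving[of T n y] nT by simp
    then have "norm (f x) \<le> norm \<mu> ^ n * C"
      using C[of y] y pow[of n y] by (auto simp: norm_mult norm_power intro: mult_left_mono)
    also have "\<dots> < norm (f x)" using n C0 by (simp add: field_simps)
    finally show False by simp
  qed
  ultimately show ?thesis by simp
qed

text \<open>Orbits stay on spheres, so a Jordan block of size two would make \<open>f (T\<^sup>n v)\<close> grow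
  linearly in \<open>n\<close>.\<close>

lemma no_jordan_block:
  fixes T :: "'a::euclidean_space \<Rightarrow> 'a" and f g :: "'a \<Rightarrow> complex"
  assumes T: "orthogonal_transformation T" and cont: "continuous_on UNIV f" "continuous_on UNIV g"
    and ev: "\<And>v. g (T v) = \<mu> * g v" and jordan: "\<And>v. f (T v) = \<mu> * f v + g v"
  shows "g x = 0"
proof (rule ccontr)
  assume nz: "g x \<noteq> 0"
  have \<mu>: "norm \<mu> = 1" using eigenvalue_norm_1[OF T cont(2) ev nz] .
  then have \<mu>0: "\<mu> \<noteq> 0" by auto
  obtain C where C: "\<And>y. norm y = norm x \<Longrightarrow> norm (f y) \<le> C"
    using continuous_bounded_on_sphere[OF cont(1)] by blast
  have nT: "norm (T v) = norm v" for v using T by (simp add: orthogonal_transformation_norm)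
  have g_pow: "g ((T ^^ n) v) = \<mu> ^ n * g v" for n v by (induction n) (simp_all add: ev)
  \<comment> \<open>The factor \<open>\<mu>\<close> on the left keeps the exponent at
    \<open>n\<close>; without it the growing term would carry the exponent
    \<open>n - 1\<close>.\<close>
  have f_pow: "\<mu> * f ((T ^^ n) v) = \<mu> ^ n * (\<mu> * f v + of_nat n * g v)" for n v
  proof (induction n)
    case (Suc n)
    have "\<mu> * f ((T ^^ Suc n) v) = \<mu> * (\<mu> * f ((T ^^ n) v)) + \<mu> * (\<mu> ^ n * g v)"
      by (simp add: jordan g_pow algebra_simps)
    then show ?case unfolding Suc by (simp add: algebra_simps)
  qed simp
  obtain n where n: "norm (f x) + C < of_nat n * norm (g x)"
    using reals_Archimedean3[of "norm (g x)"] nz by auto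
  have "of_nat n * norm (g x) = norm (of_nat n * g x)" by (simp add: norm_mult)
  also have "\<dots> \<le> norm (\<mu> * f x + of_nat n * g x) + norm (\<mu> * f x)"
    using norm_triangle_ineq4[of "\<mu> * f x + of_nat n * g x" "\<mu> * f x"] by simp
  also have "norm (\<mu> * f x + of_nat n * g x) = norm (f ((T ^^ n) x))"
    using arg_cong[OF f_pow[of n x], of norm] \<mu> by (simp add: norm_mult norm_power)
  also have "\<dots> \<le> C" by (rule C) (simp add: funpow_norm_preserving nT)
  finally show False using n \<mu> by (simp add: norm_mult)
qed

text \<open>Induction on the degree of \<open>p\<close>. Splitting off a root
  \<open>\<mu>\<^sub>0\<close> leaves the form \<open>g\<close> below, which the induction
  hypothesis decomposes. Its parts with other eigenvalues can be corrected for in \<open>f\<close>;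
  the remainder satisfies a Jordan relation for \<open>\<mu>\<^sub>0\<close>, and
  \<open>no_jordan_block\<close> makes it an eigenform.\<close>

lemma linear_sum_of_eigenforms:
  fixes T :: "'a::euclidean_space \<Rightarrow> 'a" and f :: "'a \<Rightarrow> complex"
  assumes T: "orthogonal_transformation T"
    and "p \<noteq> 0" "linear f" "\<And>v. poly_act T p f v = 0"
  shows "\<exists>(n::nat) w \<mu>. (\<forall>i. linear (w i) \<and> (\<forall>v. w i (T v) = \<mu> i * w i v)) \<and>
    (\<forall>v. f v = (\<Sum>i<n. w i v))"
  using assms(2-)
proof (induction "degree p" arbitrary: p f)
  case 0
  then obtain c where "p = [:c:]" "c \<noteq> 0" by (metis degree_eq_zeroE pCons_0_0)
  with 0(4) have "f v = 0" for v by simp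
  then show ?case
    by (intro exI[of _ 0] exI[of _ "\<lambda>i v. 0"]) (auto simp: linear_iff)
next
  case (Suc d)
  have "\<not> constant (poly p)" using Suc.hyps(2) by (simp add: constant_degree)
  then obtain \<mu>\<^sub>0 where "poly p \<mu>\<^sub>0 = 0" using fundamental_theorem_of_algebra by blast
  then obtain q where q: "p = q * [:- \<mu>\<^sub>0, 1:]" by (metis poly_eq_0_iff_dvd dvd_def mult.commute)
  with Suc.prems(1) have q0: "q \<noteq> 0" by auto
  have linT: "linear T" using T by (simp add: orthogonal_transformation_def)
  define g where "g v = f (T v) - \<mu>\<^sub>0 * f v" for v
  have "linear g"
    using Suc.prems(2) linT unfolding g_def
    by (simp add: linear_iff algebra_simps)
  moreover have "d = degree q" 
    using Suc.hyps(2) degree_mult_eq[OF q0, of "[:- \<mu>\<^sub>0, 1:]"] by (simp add: q del: mult_pCons_right)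
  moreover have "poly_act T q g v = 0" for v
  proof -
    have "poly_act T [:- \<mu>\<^sub>0, 1:] f = g" by (auto simp: g_def)
    then show ?thesis using Suc.prems(3)[of v] by (simp only: q poly_act_mult)
  qed
  ultimately obtain n w \<mu> where w: "\<And>i. linear (w i)" "\<And>i v. w i (T v) = \<mu> i * w i v"
    and g: "\<And>v. g v = (\<Sum>i<n::nat. w i v)"
    using Suc.hyps(1)[of q g] q0 by blast
  \<comment> \<open>Pullback minus \<open>\<mu>\<^sub>0\<close> multiplies \<open>w i\<close> by
    \<open>\<mu> i - \<mu>\<^sub>0\<close>, so \<open>w' i\<close> is a preimage of
    \<open>w i\<close> if the eigenvalues differ. The value 0 in the other case leaves
    \<open>w i\<close> to \<open>g'\<close>.\<close>
  define w' where "w' i v = (if \<mu> i = \<mu>\<^sub>0 then 0 else w i v / (\<mu> i - \<mu>\<^sub>0))" for i v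
  define f' where "f' v = f v - (\<Sum>i<n. w' i v)" for v
  define g' where "g' v = (\<Sum>i<n. if \<mu> i = \<mu>\<^sub>0 then w i v else 0)" for v
  have lin_w': "linear (w' i)" for i
    using w(1)[of i] by (auto simp: w'_def linear_iff add_divide_distrib scaleR_conv_of_real)
  have lin_f': "linear f'"
    unfolding f'_def by (intro linear_compose_sub Suc.prems(2) linear_compose_sum lin_w' ballI)
  have lin_g': "linear g'"
    unfolding g'_def
  proof (intro linear_compose_sum ballI)
    show "linear (\<lambda>v. if \<mu> i = \<mu>\<^sub>0 then w i v else 0)" for i
      using w(1)[of i] by (cases "\<mu> i = \<mu>\<^sub>0") (auto simp: linear_iff)
  qed
  have ev_w': "w' i (T v) = \<mu> i * w' i v" for i v by (simp add: w'_def w(2))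
  have jordan: "f' (T v) = \<mu>\<^sub>0 * f' v + g' v" for v
  proof -
    have "f (T v) = \<mu>\<^sub>0 * f v + (\<Sum>i<n. w i v)" using g[of v] by (simp add: g_def algebra_simps)
    moreover have "(\<Sum>i<n. w i v) = g' v + (\<Sum>i<n. w' i (T v)) - \<mu>\<^sub>0 * (\<Sum>i<n. w' i v)"
      unfolding g'_def sum_distrib_left sum.distrib[symmetric] sum_subtractf[symmetric]
      by (rule sum.cong) (auto simp: w'_def w(2) divide_simps algebra_simps)
    ultimately show ?thesis by (simp add: f'_def algebra_simps)
  qed
  have ev_g': "g' (T v) = \<mu>\<^sub>0 * g' v" for v
    unfolding g'_def sum_distrib_left by (rule sum.cong) (auto simp: w(2))
  have "g' v = 0" for v
    by (rule no_jordan_block[where f = f' and g = g', OF T _ _ ev_g' jordan])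
       (simp_all add: lin_f' lin_g' linear_continuous_on linear_conv_bounded_linear[symmetric])
  then have ev_f': "f' (T v) = \<mu>\<^sub>0 * f' v" for v using jordan by simp
  show ?case
  proof (intro exI conjI allI)
    fix i v
    show "linear ((w'(n := f')) i)" using lin_w' lin_f' by simp
    show "(w'(n := f')) i (T v) = (\<mu>(n := \<mu>\<^sub>0)) i * (w'(n := f')) i v"
      using ev_w' ev_f' by simp
    show "f v = (\<Sum>i<Suc n. (w'(n := f')) i v)"
      by (simp add: f'_def)
  qed
qed

text \<open>Each coordinate function is decomposed separately, so an eigenform is indexed by a
  coordinate and a position in its sum. The forms may be linearly dependent; what counts is that
  they span the coordinate functions.\<close>

lemma exists_eigenform_coordinates:
  fixes R :: "real ^ 'm ^ 'm::finite"
  assumes "orthogonal_matrix R"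
  shows "\<exists>(K :: ('m \<times> nat) set) z \<mu>. finite K \<and>
    (\<forall>k. linear (z k) \<and> norm (\<mu> k :: complex) = 1 \<and> (\<forall>v. z k (R *v v) = \<mu> k * z k v)) \<and>
    (\<forall>j. \<exists>I\<subseteq>K. \<forall>v. complex_of_real (v $ j) = (\<Sum>k\<in>I. z k v))"
proof -
  have T: "orthogonal_transformation ((*v) R)"
    
    using assms by (simp add: orthogonal_transformation_matrix)
  have lin: "linear (\<lambda>v::real^'m. complex_of_real (v $ j))" for j 
    unfolding linear_iff by (simp add: scaleR_conv_of_real[where 'a = complex])
  have "\<exists>(n::nat) w \<mu>. (\<forall>i. linear (w i) \<and> (\<forall>v. w i (R *v v) = \<mu> i * w i v)) \<and>
    (\<forall>v. complex_of_real (v $ j) = (\<Sum>i<n. w i v))" for j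
    using exists_annihilating_poly[of R j] linear_sum_of_eigenforms[OF T _ lin[of j]] by metis
  then obtain n w \<mu> where w: "\<And>j i. linear (w j i)" "\<And>j i v. w j i (R *v v) = \<mu> j i * w j i v"
    and sum_w: "\<And>j v. complex_of_real (v $ j) = (\<Sum>i<n j::nat. w j i v)"
    by metis
  \<comment> \<open>A zero form satisfies the eigenvalue equation for every number. Resetting its
    eigenvalue to 1 gives modulus one for all indices.\<close>
  define \<nu> where "\<nu> k = (case k of (j, i) \<Rightarrow> if \<forall>v. w j i v = 0 then 1 else \<mu> j i)" for k
  have "norm (\<nu> k) = 1" for k
  proof (cases k)
    case (Pair j i)
    have "norm (\<mu> j i) = 1" if "w j i v \<noteq> 0" for v
      by (rule eigenvalue_norm_1[OF T _ w(2) that])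
        (simp add: w(1) linear_continuous_on linear_conv_bounded_linear[symmetric])
    then show ?thesis by (auto simp: \<nu>_def Pair)
  qed
  moreover have "case_prod w k (R *v v) = \<nu> k * case_prod w k v" for k v
    by (auto simp: \<nu>_def w(2) split: prod.split)
  moreover have "linear (case_prod w k)" for k by (cases k) (simp add: w(1))
  moreover have "\<exists>I\<subseteq>Sigma UNIV (\<lambda>j. {..<n j}). \<forall>v. complex_of_real (v $ j) = (\<Sum>k\<in>I. case_prod w k v)" for j
  proof (intro exI conjI allI)
    show "Pair j ` {..<n j} \<subseteq> Sigma UNIV (\<lambda>j. {..<n j})" by auto
    show "complex_of_real (v $ j) = (\<Sum>k\<in>Pair j ` {..<n j}. case_prod w k v)" for v
      by (simp add: sum_w sum.reindex inj_on_def)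
  qed
  ultimately show ?thesis
    by (intro exI[of _ "Sigma UNIV (\<lambda>j. {..<n j})"] exI[of _ "case_prod w"] exI[of _ \<nu>]) auto
qed


section \<open>Monomials in eigenforms\<close>

definition monomial :: "'k set \<Rightarrow> ('k \<Rightarrow> 'v \<Rightarrow> complex) \<Rightarrow> ('k \<Rightarrow> nat) \<Rightarrow> 'v \<Rightarrow> complex" where
  "monomial K z a v = (\<Prod>k\<in>K. z k v ^ a k)"

text \<open>The eigenvalue of the monomial with exponents \<open>a\<close> when each
  \<open>z k\<close> has eigenvalue \<open>\<mu> k\<close>; see
  \<open>monomial_eigen\<close>.\<close>

definition weight :: "'k set \<Rightarrow> ('k \<Rightarrow> complex) \<Rightarrow> ('k \<Rightarrow> nat) \<Rightarrow> complex" where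
  "weight K \<mu> a = (\<Prod>k\<in>K. \<mu> k ^ a k)"

lemma monomial_add: "monomial K z (\<lambda>k. a k + b k) v = monomial K z a v * monomial K z b v"
  by (simp add: monomial_def power_add prod.distrib)

lemma weight_add: "weight K \<mu> (\<lambda>k. a k + b k) = weight K \<mu> a * weight K \<mu> b"
  by (simp add: weight_def power_add prod.distrib)

lemma monomial_cong: "(\<And>k. k \<in> K \<Longrightarrow> a k = b k) \<Longrightarrow> monomial K z a = monomial K z b"
  by (simp add: monomial_def fun_eq_iff)

lemma weight_cong: "(\<And>k. k \<in> K \<Longrightarrow> a k = b k) \<Longrightarrow> weight K \<mu> a = weight K \<mu> b"
  by (simp add: weight_def)

lemma monomial_eigen:
  assumes "\<And>k v. k \<in> K \<Longrightarrow> z k (T v) = \<mu> k * z k v"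
  shows "monomial K z a (T v) = weight K \<mu> a * monomial K z a v"
  by (simp add: monomial_def weight_def assms power_mult_distrib prod.distrib)

lemma monomial_single:
  assumes "finite K" "k \<in> K"
  shows "monomial K z (\<lambda>l. if l = k then 1 else 0) = z k"
proof
  fix v
  have "monomial K z (\<lambda>l. if l = k then 1 else 0) v = (\<Prod>l\<in>K. if l = k then z k v else 1)"
    unfolding monomial_def by (rule prod.cong) auto
  then show "monomial K z (\<lambda>l. if l = k then 1 else 0) v = z k v"
    using assms by simp
qed

section \<open>Complex combinations of monomials\<close>

inductive_set complex_span :: "('v \<Rightarrow> complex) set \<Rightarrow> ('v \<Rightarrow> complex) set"
  for M :: "('v \<Rightarrow> complex) set" where
  zero: "(\<lambda>v. 0) \<in> complex_span M"
| scaled: "m \<in> M \<Longrightarrow> (\<lambda>v. c * m v) \<in> complex_span M"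
| add: "f \<in> complex_span M \<Longrightarrow> g \<in> complex_span M \<Longrightarrow> (\<lambda>v. f v + g v) \<in> complex_span M"

lemma complex_span_base: "m \<in> M \<Longrightarrow> m \<in> complex_span M"
  using complex_span.scaled[of m M 1] by simp

lemma complex_span_scale: "f \<in> complex_span M \<Longrightarrow> (\<lambda>v. c * f v) \<in> complex_span M"
proof (induction rule: complex_span.induct)
  case (scaled m d)
  then show ?case using complex_span.scaled[of m M "c * d"] by (simp add: mult.assoc)
next
  case (add f g)
  then show ?case using complex_span.add[of "\<lambda>v. c * f v" M "\<lambda>v. c * g v"]
    by (simp add: distrib_left)
qed (simp add: complex_span.zero)

lemma complex_span_sum:
  assumes "\<And>i. i \<in> I \<Longrightarrow> f i \<in> complex_span M"
  shows "(\<lambda>v. \<Sum>i\<in>I. f i v) \<in> complex_span M"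
proof (cases "finite I")
  case True
  then show ?thesis using assms
    by (induction I) (simp_all add: complex_span.zero complex_span.add)
qed (simp add: complex_span.zero)

lemma complex_span_mult:
  assumes closed: "\<And>m m'. m \<in> M \<Longrightarrow> m' \<in> M \<Longrightarrow> (\<lambda>v. m v * m' v) \<in> M"
    and f: "f \<in> complex_span M" and g: "g \<in> complex_span M"
  shows "(\<lambda>v. f v * g v) \<in> complex_span M"
  using f
proof (induction rule: complex_span.induct)
  case (scaled m c)
  \<comment> \<open>With the generator \<open>m\<close> fixed, an inner induction runs over the
    other factor, so that \<open>closed\<close> only meets pairs of generators.\<close>
  have "(\<lambda>v. m v * g v) \<in> complex_span M"
    using g
  proof (induction rule: complex_span.induct)
    case (scaled m' d)
    show ?case
      using complex_span.scaled[OF closed[OF \<open>m \<in> M\<close> \<open>m' \<in> M\<close>], of d] by (simp add: mult_ac)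
  next
    case (add g h)
    then show ?case using complex_span.add[of "\<lambda>v. m v * g v" M "\<lambda>v. m v * h v"]
      by (simp add: distrib_left)
  qed (simp add: complex_span.zero)
  then show ?case using complex_span_scale[of "\<lambda>v. m v * g v" M c] by (simp add: mult.assoc)
next
  case (add f h)
  then show ?case using complex_span.add[of "\<lambda>v. f v * g v" M "\<lambda>v. h v * g v"]
    by (simp add: distrib_right)
qed (simp add: complex_span.zero)

text \<open>The monomials include 1 and are closed under products, so their span is an algebra;
  containing the coordinates, it contains every polynomial.\<close>

lemma real_polynomial_in_monomial_span:
  fixes f :: "real ^ 'n::finite \<Rightarrow> real"
  assumes f: "real_polynomial_function f"
    and coord: "\<And>j. (\<lambda>v. complex_of_real (v $ j)) \<in> complex_span (range (monomial K z))"
  shows "(\<lambda>v. complex_of_real (f v)) \<in> complex_span (range (monomial K z))"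
proof -
  have closed: "(\<lambda>v. m v * m' v) \<in> range (monomial K z)"
    if "m \<in> range (monomial K z)" "m' \<in> range (monomial K z)" for m m'
    using that by (auto simp: monomial_add[symmetric])
  show ?thesis
    using f
  proof (induction rule: real_polynomial_function.induct)
    case (linear f)
    have eq: "(\<Sum>j\<in>UNIV. complex_of_real (f (axis j 1)) * of_real (v $ j)) = of_real (f v)" for v
    proof -
      have "f v = f (\<Sum>j\<in>UNIV. v $ j *\<^sub>R axis j 1)"
        by (simp add: basis_expansion scalar_mult_eq_scaleR[symmetric])
      also have "\<dots> = (\<Sum>j\<in>UNIV. f (axis j 1) * v $ j)"
        using linear by (simp add: linear_simps linear_sum bounded_linear.linear mult.commute)
      finally show ?thesis by simp
    qed
    have "(\<lambda>v. \<Sum>j\<in>UNIV. complex_of_real (f (axis j 1)) * of_real (v $ j))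
        \<in> complex_span (range (monomial K z))"
      by (intro complex_span_sum complex_span_scale coord)
    then show ?case by (simp only: eq)
  next
    case (const c)
    have "monomial K z (\<lambda>k. 0) = (\<lambda>v. 1)" by (simp add: monomial_def fun_eq_iff)
    then have "(\<lambda>v. 1) \<in> range (monomial K z)" by (metis rangeI)
    then show ?case
      using complex_span.scaled[of "\<lambda>v. 1" "range (monomial K z)" "of_real c"] by simp
  next
    case (add f g)
    then show ?case by (simp add: complex_span.add)
  next
    case (mult f g)
    then show ?case by (simp add: complex_span_mult[OF closed])
  qed
qed

text \<open>An element of the span is a sum \<open>h + r\<close> with \<open>h\<close> of weight one and \<open>r\<close> killed by some
  \<open>p(T)\<close> with \<open>p(1) \<noteq> 0\<close>; if the sum is invariant, so is \<open>r\<close>, and then \<open>0 = p(T) r = p(1) r\<close>.\<close>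

lemma invariant_in_span_of_weight_one:
  assumes ev: "\<And>k v. k \<in> K \<Longrightarrow> z k (T v) = \<mu> k * z k v"
    and f: "f \<in> complex_span (range (monomial K z))" and inv: "\<And>v. f (T v) = f v"
  shows "f \<in> complex_span (monomial K z ` {a. weight K \<mu> a = 1})" (is "_ \<in> ?S")
proof -
  have h_inv: "h (T v) = h v" if "h \<in> ?S" for h v
    using that by (induction rule: complex_span.induct) (auto simp: monomial_eigen[of K z T \<mu>, OF ev])
  have "\<exists>h\<in>?S. \<exists>p. poly p 1 \<noteq> 0 \<and> (\<forall>v. poly_act T p (\<lambda>v. f v - h v) v = 0)"
    using f
  proof (induction rule: complex_span.induct)
    case zero
    show ?case
      by (intro bexI[of _ "\<lambda>v. 0"] exI[of _ 1]) (simp_all add: complex_span.zero poly_act_zero_fun)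
  next
    case (scaled m c)
    then obtain a where m: "m = monomial K z a" by auto
    show ?case
    proof (cases "weight K \<mu> a = 1")
      case True
      then show ?thesis
        by (intro bexI[of _ "\<lambda>v. c * m v"] exI[of _ 1])
          (simp_all add: poly_act_zero_fun m complex_span.scaled)
    next
      case False
      \<comment> \<open>The linear polynomial whose root is the weight kills this monomial, and it
        does not vanish at 1 because the weight is not 1.\<close>
      then show ?thesis
        by (intro bexI[of _ "\<lambda>v. 0"] exI[of _ "[:- weight K \<mu> a, 1:]"])
          (simp_all add: m monomial_eigen[of K z T \<mu>, OF ev] complex_span.zero)
    qed
  next
    case (add f g)
    then obtain h p h' p' where h: "h \<in> ?S" "h' \<in> ?S" "poly p 1 \<noteq> 0" "poly p' 1 \<noteq> 0"
      and p: "\<And>v. poly_act T p (\<lambda>v. f v - h v) v = 0"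
      and p': "\<And>v. poly_act T p' (\<lambda>v. g v - h' v) v = 0"
      by blast
    have "poly_act T (p * p') (\<lambda>v. f v + g v - (h v + h' v)) v = 0" for v
    proof -
      \<comment> \<open>The product is written in both orders so that each summand first meets the
        factor that kills it.\<close>
      have "poly_act T (p * p') (\<lambda>v. f v + g v - (h v + h' v)) v
          = poly_act T (p' * p) (\<lambda>v. f v - h v) v + poly_act T (p * p') (\<lambda>v. g v - h' v) v"
        by (simp add: poly_act_add_fun[symmetric] mult.commute algebra_simps)
      also have "\<dots> = 0"
      proof -
        have "poly_act T p (\<lambda>v. f v - h v) = (\<lambda>v. 0)" "poly_act T p' (\<lambda>v. g v - h' v) = (\<lambda>v. 0)"
          using p p' by auto
        then show ?thesis by (simp add: poly_act_mult poly_act_zero_fun)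
      qed
      finally show ?thesis .
    qed
    then show ?case
      using h by (intro bexI[of _ "\<lambda>v. h v + h' v"] exI[of _ "p * p'"]) (auto intro: complex_span.add)
  qed
  then obtain h p where h: "h \<in> ?S" "poly p 1 \<noteq> 0"
    and p: "\<And>v. poly_act T p (\<lambda>v. f v - h v) v = 0" by blast
  have "poly_act T p (\<lambda>v. f v - h v) v = poly p 1 * (f v - h v)" for v
    by (rule poly_act_invariant) (simp add: inv h_inv[OF h(1)])
  then have "f = h" using h(2) p by (auto simp: fun_eq_iff)
  then show ?thesis using h(1) by simp
qed

section \<open>Finite generation\<close>

text \<open>Induction on the set of coordinates. Ignoring the new coordinate \<open>x\<close> gives
  \<open>F\<close>, which serves every \<open>a\<close> whose value at \<open>x\<close> reaches the
  bound \<open>N\<close> on \<open>F\<close>. The finitely many smaller values of \<open>a x\<close>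
  are treated slice by slice.\<close>

lemma dickson:
  fixes M :: "('k \<Rightarrow> nat) set"
  assumes "finite K"
  shows "\<exists>F\<subseteq>M. finite F \<and> (\<forall>a\<in>M. \<exists>b\<in>F. \<forall>k\<in>K. b k \<le> a k)"
  using assms
proof (induction K arbitrary: M)
  case empty
  show ?case
  proof (cases "M = {}")
    case False
    then obtain a where "a \<in> M" by blast
    then show ?thesis by (intro exI[of _ "{a}"]) auto
  qed auto
next
  case (insert x K)
  obtain F where F: "F \<subseteq> M" "finite F" "\<And>a. a \<in> M \<Longrightarrow> \<exists>b\<in>F. \<forall>k\<in>K. b k \<le> a k"
    using insert.IH[of M] by blast
  obtain N where N: "\<And>b. b \<in> F \<Longrightarrow> b x \<le> N"
    using finite_nat_set_iff_bounded_le[of "(\<lambda>b. b x) ` F"] F(2) by auto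
  have "\<forall>t. \<exists>G. G \<subseteq> {a \<in> M. a x = t} \<and> finite G \<and>
      (\<forall>a\<in>{a \<in> M. a x = t}. \<exists>b\<in>G. \<forall>k\<in>K. b k \<le> a k)"
    using insert.IH by blast
  then obtain G where "\<forall>t. G t \<subseteq> {a \<in> M. a x = t} \<and> finite (G t) \<and>
      (\<forall>a\<in>{a \<in> M. a x = t}. \<exists>b\<in>G t. \<forall>k\<in>K. b k \<le> a k)"
    by (rule choice[THEN exE])
  then have G: "\<And>t. G t \<subseteq> {a \<in> M. a x = t}" "\<And>t. finite (G t)"
    "\<And>t a. a \<in> M \<Longrightarrow> a x = t \<Longrightarrow> \<exists>b\<in>G t. \<forall>k\<in>K. b k \<le> a k"
    by auto
  show ?case
  proof (intro exI[of _ "F \<union> (\<Union>t<N. G t)"] conjI ballI)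
    fix a assume a: "a \<in> M"
    show "\<exists>b\<in>F \<union> (\<Union>t<N. G t). \<forall>k\<in>insert x K. b k \<le> a k"
    proof (cases "a x < N")
      case True
      obtain b where "b \<in> G (a x)" "\<forall>k\<in>K. b k \<le> a k" using G(3)[OF a] by blast
      then show ?thesis using True G(1)[of "a x"] by (intro bexI[of _ b]) auto
    next
      case False
      obtain b where "b \<in> F" "\<forall>k\<in>K. b k \<le> a k" using F(3)[OF a] by blast
      then show ?thesis using False N[of b] by (intro bexI[of _ b]) auto
    qed
  next
    show "F \<union> (\<Union>t<N. G t) \<subseteq> M" using F(1) G(1) by blast
    show "finite (F \<union> (\<Union>t<N. G t))" using F(2) G(2) by simp
  qed
qed

section \<open>Real algebras tested on complex functions\<close>

definition real_subalgebra :: "('v \<Rightarrow> real) set \<Rightarrow> bool" where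
  "real_subalgebra C \<longleftrightarrow> (\<forall>c. (\<lambda>v. c) \<in> C) \<and>
     (\<forall>f\<in>C. \<forall>g\<in>C. (\<lambda>v. f v + g v) \<in> C \<and> (\<lambda>v. f v * g v) \<in> C)"

text \<open>For a real algebra \<open>C\<close>, membership of \<open>f\<close> in its
  complexification. Products of complex eigenforms can thus be handled through real
  algebras.\<close>

definition parts_in :: "('v \<Rightarrow> real) set \<Rightarrow> ('v \<Rightarrow> complex) \<Rightarrow> bool" where
  "parts_in C f \<longleftrightarrow> (\<lambda>v. Re (f v)) \<in> C \<and> (\<lambda>v. Im (f v)) \<in> C"

lemma real_subalgebra_generated: "real_subalgebra (subalgebra_generated U)"
  by (auto simp: real_subalgebra_def intro: subalgebra_generated.intros)

lemma real_subalgebra_invariants: "real_subalgebra (invariant_polynomials G)"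
  by (auto simp: real_subalgebra_def invariant_polynomials_def)

lemma subalgebra_generated_least:
  assumes "real_subalgebra C" "U \<subseteq> C"
  shows "subalgebra_generated U \<subseteq> C"
proof
  fix f assume "f \<in> subalgebra_generated U"
  then show "f \<in> C"
    using assms by induction (auto simp: real_subalgebra_def)
qed

text \<open>Substituting \<open>h\<close> is an algebra homomorphism, so it suffices to know where
  the generators go.\<close>

lemma subalgebra_generated_compose:
  assumes "f \<in> subalgebra_generated U" "(\<lambda>u v. u (h v)) ` U \<subseteq> C" "real_subalgebra C"
  shows "(\<lambda>v. f (h v)) \<in> C"
  using assms(1)
proof induction
  case (base f)
  then show ?case using assms(2) by blast
qed (use assms(3) in \<open>auto simp: real_subalgebra_def\<close>)

lemma parts_in_const: "real_subalgebra C \<Longrightarrow> parts_in C (\<lambda>v. c)"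
  by (auto simp: parts_in_def real_subalgebra_def)

lemma parts_in_add:
  "real_subalgebra C \<Longrightarrow> parts_in C f \<Longrightarrow> parts_in C g \<Longrightarrow> parts_in C (\<lambda>v. f v + g v)"
  by (auto simp: parts_in_def real_subalgebra_def)

lemma parts_in_mult:
  assumes C: "real_subalgebra C" and f: "parts_in C f" and g: "parts_in C g"
  shows "parts_in C (\<lambda>v. f v * g v)"
proof -
  \<comment> \<open>The real part of a product is a difference, which \<open>real_subalgebra\<close>
    yields through the constant -1.\<close>
  have "(\<lambda>v. a v - b v) \<in> C" if "a \<in> C" "b \<in> C" for a b
  proof -
    have closed: "(\<lambda>v. f v + g v) \<in> C" "(\<lambda>v. f v * g v) \<in> C" "(\<lambda>v. c) \<in> C"
      if "f \<in> C" "g \<in> C" for f g c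
      using C that by (simp_all add: real_subalgebra_def)
    have "(\<lambda>v. a v + (- 1) * b v) \<in> C"
      by (rule closed(1)[OF that(1) closed(2)[OF closed(3)[OF that] that(2)]])
    then show ?thesis by simp
  qed
  then show ?thesis
    using C f g by (auto simp: parts_in_def real_subalgebra_def)
qed

lemma parts_in_power: "real_subalgebra C \<Longrightarrow> parts_in C f \<Longrightarrow> parts_in C (\<lambda>v. f v ^ n)"
  by (induction n) (simp_all add: parts_in_const parts_in_mult)

lemma parts_in_monomial:
  assumes C: "real_subalgebra C" and "finite K" "\<And>k. k \<in> K \<Longrightarrow> parts_in C (z k)"
  shows "parts_in C (monomial K z a)"
proof -
  have "parts_in C (\<lambda>v. \<Prod>k\<in>K. z k v ^ a k)"
    using assms(2,3)
    by (induction K) (simp_all add: parts_in_const parts_in_mult parts_in_power C)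
  then show ?thesis by (simp add: monomial_def[abs_def])
qed

lemma parts_in_complex_span:
  assumes "real_subalgebra C" "\<And>m. m \<in> M \<Longrightarrow> parts_in C m" "f \<in> complex_span M"
  shows "parts_in C f"
  using assms(3)
  by induction (simp_all add: assms parts_in_const parts_in_add parts_in_mult)

text \<open>Subtracting a weight-one exponent from a larger one leaves weight one, so the finitely
  many exponents supplied by \<open>dickson\<close> generate all others. \<open>F\<close> is fixed
  before \<open>C\<close>, since \<open>C\<close> may itself be generated from
  \<open>F\<close>.\<close>

lemma weight_one_monomials_finitely_generated:
  assumes K: "finite K"
  shows "\<exists>F. finite F \<and> (\<forall>b\<in>F. weight K \<mu> b = 1) \<and>
    (\<forall>C. real_subalgebra C \<longrightarrow> (\<forall>b\<in>F. parts_in C (monomial K z b)) \<longrightarrow>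
      (\<forall>a. weight K \<mu> a = 1 \<longrightarrow> parts_in C (monomial K z a)))"
proof -
  \<comment> \<open>Leaving out exponents that vanish on \<open>K\<close> ensures that subtracting
    an element of \<open>F\<close> lowers the total degree, on which the induction runs.\<close>
  define M where "M = {a. weight K \<mu> a = 1 \<and> (\<exists>k\<in>K. a k \<noteq> 0)}"
  obtain F where F: "F \<subseteq> M" "finite F" "\<And>a. a \<in> M \<Longrightarrow> \<exists>b\<in>F. \<forall>k\<in>K. b k \<le> a k"
    using dickson[OF K, of M] by blast
  have "parts_in C (monomial K z a)"
    if C: "real_subalgebra C" and gens: "\<forall>b\<in>F. parts_in C (monomial K z b)"
      and "weight K \<mu> a = 1" for C a
    using that(3)
  proof (induction "\<Sum>k\<in>K. a k" arbitrary: a rule: less_induct)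
    case less
    show ?case
    proof (cases "a \<in> M")
      case False
      then have "\<forall>k\<in>K. a k = 0" using less.prems by (auto simp: M_def)
      then have "monomial K z a = (\<lambda>v. 1)" by (simp add: monomial_def fun_eq_iff)
      then show ?thesis by (simp add: parts_in_const C)
    next
      case True
      then obtain b where b: "b \<in> F" "\<And>k. k \<in> K \<Longrightarrow> b k \<le> a k" using F(3) by blast
      define d where "d k = a k - b k" for k
      have a: "a k = b k + d k" if "k \<in> K" for k using b(2)[OF that] by (simp add: d_def)
      have "b \<in> M" using b(1) F(1) by blast
      have "weight K \<mu> a = weight K \<mu> b * weight K \<mu> d"
        using weight_cong[of K a "\<lambda>k. b k + d k"] a by (simp add: weight_add)
      then have "weight K \<mu> d = 1" using less.prems \<open>b \<in> M\<close> by (simp add: M_def)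
      moreover have "(\<Sum>k\<in>K. d k) < (\<Sum>k\<in>K. a k)"
      proof -
        obtain k where "k \<in> K" "b k \<noteq> 0" using \<open>b \<in> M\<close> by (auto simp: M_def)
        then show ?thesis
          by (intro sum_strict_mono_ex1[OF K]) (auto simp: a intro!: bexI[of _ k])
      qed
      ultimately have "parts_in C (monomial K z d)" by (rule less.hyps[rotated])
      moreover have "monomial K z a = (\<lambda>v. monomial K z b v * monomial K z d v)"
        using monomial_cong[of K a "\<lambda>k. b k + d k" z] a by (simp add: monomial_add fun_eq_iff)
      ultimately show ?thesis using gens b(1) by (simp add: parts_in_mult C)
    qed
  qed
  then show ?thesis using F by (intro exI[of _ F]) (auto simp: M_def)
qed

section \<open>Invariants of cyclic matrix groups\<close>

lemma invariant_polynomials_generate: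
  fixes A :: "real ^ 'k ^ 'k::finite"
  assumes "group G" and mult: "monoid.mult G = (**)" and one: "one G = mat 1"
    and A: "A \<in> carrier G"
  shows "invariant_polynomials (generate G {A})
    = {f. real_polynomial_function f \<and> (\<forall>v. f (A *v v) = f v)}"
proof -
  have "f (B *v v) = f v" if f: "\<And>v. f (A *v v) = f v" and "B \<in> generate G {A}"
    for f :: "real ^ 'k \<Rightarrow> real" and B v
    using that(2)
  proof (induction arbitrary: v rule: generate.induct)
    case (inv h)
    have "A ** (inv\<^bsub>G\<^esub> A) = mat 1"
      using group.r_inv[OF assms(1) A] by (simp add: mult one)
    \<comment> \<open>Invariance under the inverse is invariance under \<open>A\<close> at the point
      to which the inverse moves \<open>v\<close>.\<close>
    then show ?case
      using f[of "(inv\<^bsub>G\<^esub> A) *v v"] inv by (simp add: matrix_vector_mul_assoc)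
  next
    case (eng h k)
    then show ?case by (simp add: mult matrix_vector_mul_assoc[symmetric])
  qed (simp_all add: one f)
  then show ?thesis
    by (auto simp: invariant_polynomials_def intro: generate.incl)
qed

lemma invariant_polynomials_orthogonal:
  assumes "R \<in> carrier orthogonal_group"
  shows "invariant_polynomials (generate orthogonal_group {R})
    = {f. real_polynomial_function f \<and> (\<forall>v. f (R *v v) = f v)}"
  by (rule invariant_polynomials_generate[OF group_orthogonal_group _ _ assms])
    (simp_all add: orthogonal_group_def GL_group_def)

lemma invariant_polynomials_lorentz:
  assumes "A \<in> carrier lorentz_group"
  shows "invariant_polynomials (generate lorentz_group {A})
    = {f. real_polynomial_function f \<and> (\<forall>v. f (A *v v) = f v)}"
  by (rule invariant_polynomials_generate[OF group_lorentz_group _ _ assms])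
    (simp_all add: lorentz_group_def GL_group_def)

lemma parts_in_real_polynomials_linear:
  fixes z :: "real ^ 'n::finite \<Rightarrow> complex"
  assumes "linear z"
  shows "parts_in {f. real_polynomial_function f} z"
  using assms
  by (auto simp: parts_in_def linear_conv_bounded_linear
      intro!: real_polynomial_function.intros(1) bounded_linear_compose[OF bounded_linear_Re]
        bounded_linear_compose[OF bounded_linear_Im])

text \<open>Weight one means eigenvalue 1 under \<open>R\<close>, and the parts are real polynomials
  because those of each linear form \<open>z k\<close> are.\<close>

lemma weight_one_monomial_invariant:
  fixes R :: "real ^ 'm ^ 'm::finite"
  assumes R: "R \<in> carrier orthogonal_group" and "finite K" and z: "\<And>k. k \<in> K \<Longrightarrow> linear (z k)"
    "\<And>k v. k \<in> K \<Longrightarrow> z k (R *v v) = \<mu> k * z k v" and "weight K \<mu> a = 1"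
  shows "parts_in (invariant_polynomials (generate orthogonal_group {R})) (monomial K z a)"
proof -
  have "real_subalgebra {f :: real ^ 'm \<Rightarrow> real. real_polynomial_function f}"
    by (auto simp: real_subalgebra_def)
  then have "parts_in {f. real_polynomial_function f} (monomial K z a)"
    using assms by (intro parts_in_monomial parts_in_real_polynomials_linear)
  moreover have "monomial K z a (R *v v) = monomial K z a v" for v
    using monomial_eigen[of K z "(*v) R" \<mu> a v, OF z(2)] assms(5) by simp
  ultimately show ?thesis
    by (simp add: parts_in_def invariant_polynomials_orthogonal[OF R])
qed

lemma hilbert_basis_orthogonal_exists:
  fixes R :: "real ^ 'm ^ 'm::finite"
  assumes R: "R \<in> carrier orthogonal_group"
  shows "\<exists>U. hilbert_basis U (invariant_polynomials (generate orthogonal_group {R}))"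
proof -
  let ?I = "invariant_polynomials (generate orthogonal_group {R})"
  have "orthogonal_matrix R" using R by (simp add: orthogonal_group_def)
  then obtain K :: "('m \<times> nat) set" and z \<mu> where K: "finite K"
    and z: "\<And>k. linear (z k)" "\<And>k v. z k (R *v v) = \<mu> k * z k v"
    and coord: "\<And>j. \<exists>I\<subseteq>K. \<forall>v. complex_of_real (v $ j) = (\<Sum>k\<in>I. z k v)"
    using exists_eigenform_coordinates[of R] by metis
  obtain F where F: "finite F" "\<And>b. b \<in> F \<Longrightarrow> weight K \<mu> b = 1"
    and gen: "\<And>C a. real_subalgebra C \<Longrightarrow> (\<forall>b\<in>F. parts_in C (monomial K z b)) \<Longrightarrow>
      weight K \<mu> a = 1 \<Longrightarrow> parts_in C (monomial K z a)"
    using weight_one_monomials_finitely_generated[OF K, of \<mu> z] by metis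
  \<comment> \<open>Real and imaginary parts make the generating monomials real. A real invariant
    \<open>f\<close> is its own real part and is therefore recovered in the real algebra generated
    by them.\<close>
  define U where "U = (\<lambda>b v. Re (monomial K z b v)) ` F \<union> (\<lambda>b v. Im (monomial K z b v)) ` F"
  have "finite U" using F by (simp add: U_def)
  have U: "U \<subseteq> ?I"
    using weight_one_monomial_invariant[OF R K z(1,2) F(2)] by (auto simp: U_def parts_in_def)
  have "?I \<subseteq> subalgebra_generated U"
  proof
    fix f assume f: "f \<in> ?I"
    then have fpoly: "real_polynomial_function f" and finv: "\<And>v. f (R *v v) = f v"
      by (auto simp: invariant_polynomials_orthogonal[OF R])
    have "(\<lambda>v. complex_of_real (v $ j)) \<in> complex_span (range (monomial K z))" for j
    proof -
      obtain I where I: "I \<subseteq> K" "\<And>v. complex_of_real (v $ j) = (\<Sum>k\<in>I. z k v)"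
        using coord by blast
      have "z k \<in> complex_span (range (monomial K z))" if "k \<in> I" for k
        using that I(1) by (subst monomial_single[OF K, of k z, symmetric]) (auto intro: complex_span_base)
      then show ?thesis by (simp add: I(2) complex_span_sum)
    qed
    then have "(\<lambda>v. complex_of_real (f v)) \<in> complex_span (range (monomial K z))"
      using real_polynomial_in_monomial_span[OF fpoly] by blast
    then have "(\<lambda>v. complex_of_real (f v)) \<in> complex_span (monomial K z ` {a. weight K \<mu> a = 1})"
      by (rule invariant_in_span_of_weight_one[where T = "(*v) R", rotated]) (simp_all add: z finv)
    moreover have "\<forall>b\<in>F. parts_in (subalgebra_generated U) (monomial K z b)"
      by (auto simp: parts_in_def U_def intro: subalgebra_generated.base)
    then have "parts_in (subalgebra_generated U) m" if "m \<in> monomial K z ` {a. weight K \<mu> a = 1}" for m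
      using that gen[OF real_subalgebra_generated] by auto
    ultimately have "parts_in (subalgebra_generated U) (\<lambda>v. complex_of_real (f v))"
      by (rule parts_in_complex_span[OF real_subalgebra_generated, rotated])
    then show "f \<in> subalgebra_generated U" by (simp add: parts_in_def)
  qed
  moreover have "subalgebra_generated U \<subseteq> ?I"
    by (rule subalgebra_generated_least[OF real_subalgebra_invariants U])
  ultimately show ?thesis
    using \<open>finite U\<close> U by (auto simp: hilbert_basis_def)
qed

section \<open>The hyperbolic block\<close>

text \<open>The null forms x + y and x - y diagonalise the hyperbolic rotation, since cosh plus or
  minus sinh is an exponential.\<close>

lemma block_diag_hyperbolic:
  fixes R :: "real ^ 'm ^ 'm::finite"
  shows "(\<chi> i. (block_diag R (hyperbolic_rotation \<beta>) *v \<eta>) $ Inl i) = R *v (\<chi> i. \<eta> $ Inl i)"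
    and "(block_diag R (hyperbolic_rotation \<beta>) *v \<eta>) $ Inr 1 + (block_diag R (hyperbolic_rotation \<beta>) *v \<eta>) $ Inr 2
      = exp \<beta> * (\<eta> $ Inr 1 + \<eta> $ Inr 2)"
    and "(block_diag R (hyperbolic_rotation \<beta>) *v \<eta>) $ Inr 1 - (block_diag R (hyperbolic_rotation \<beta>) *v \<eta>) $ Inr 2
      = exp (- \<beta>) * (\<eta> $ Inr 1 - \<eta> $ Inr 2)"
  unfolding block_diag_vec
  by (simp_all add: vec_eq_iff hyperbolic_rotation_def matrix_vector_mult_def sum_2
      cosh_plus_sinh[symmetric] cosh_minus_sinh[symmetric] algebra_simps)

text \<open>It suffices that \<open>C\<close> contains the parts of every weight-one monomial, and
  such a monomial is an \<open>R\<close>-invariant one times a power of x^2 - y^2. \<open>C\<close>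
  is left arbitrary so that it can later absorb the change of coordinates by
  \<open>P\<close>.\<close>

lemma block_invariants_subset:
  fixes R :: "real ^ 'm ^ 'm::finite" and f :: "real ^ ('m + 2) \<Rightarrow> real"
  assumes R: "R \<in> carrier orthogonal_group" and \<beta>: "\<beta> \<noteq> 0"
    and fpoly: "real_polynomial_function f"
    and finv: "\<And>\<eta>. f (block_diag R (hyperbolic_rotation \<beta>) *v \<eta>) = f \<eta>"
    and C: "real_subalgebra C"
    and C_R: "\<And>g. g \<in> invariant_polynomials (generate orthogonal_group {R}) \<Longrightarrow>
      (\<lambda>\<eta>. g (\<chi> i. \<eta> $ Inl i)) \<in> C"
    and C_q: "(\<lambda>\<eta>. (\<eta> $ Inr 1)\<^sup>2 - (\<eta> $ Inr 2)\<^sup>2) \<in> C"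
  shows "f \<in> C"
proof -
  let ?L = "block_diag R (hyperbolic_rotation \<beta>)"
  let ?pr = "\<lambda>\<eta> :: real ^ ('m + 2). \<chi> i. \<eta> $ Inl i"
  have "orthogonal_matrix R" using R by (simp add: orthogonal_group_def)
  then obtain K :: "('m \<times> nat) set" and z \<mu> where K: "finite K"
    and z: "\<And>k. linear (z k)" "\<And>k. norm (\<mu> k) = 1" "\<And>k v. z k (R *v v) = \<mu> k * z k v"
    and coord: "\<And>j. \<exists>I\<subseteq>K. \<forall>v. complex_of_real (v $ j) = (\<Sum>k\<in>I. z k v)"
    using exists_eigenform_coordinates[of R] by metis
  \<comment> \<open>The two additional indices stand for the null forms: \<open>True\<close> for x +
    y, \<open>False\<close> for x - y.\<close>
  define K' :: "('m \<times> nat + bool) set" where "K' = K <+> UNIV"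
  define z' :: "'m \<times> nat + bool \<Rightarrow> real ^ ('m + 2) \<Rightarrow> complex" where
    "z' k \<eta> = (case k of Inl l \<Rightarrow> z l (?pr \<eta>)
      | Inr b \<Rightarrow> of_real (if b then \<eta> $ Inr 1 + \<eta> $ Inr 2 else \<eta> $ Inr 1 - \<eta> $ Inr 2))" for k \<eta>
  define \<mu>' where "\<mu>' k = (case k of Inl l \<Rightarrow> \<mu> l
      | Inr b \<Rightarrow> of_real (if b then exp \<beta> else exp (- \<beta>)))" for k
  let ?S = "complex_span (range (monomial K' z'))"
  have K': "finite K'" by (simp add: K'_def K)
  have ev: "z' k (?L *v \<eta>) = \<mu>' k * z' k \<eta>" for k \<eta>
    by (cases k) (simp_all add: z'_def \<mu>'_def block_diag_hyperbolic z flip: of_real_mult)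
  have z'_span: "z' k \<in> ?S" if "k \<in> K'" for k
    using that by (subst monomial_single[OF K', of k z', symmetric]) (auto intro: complex_span_base)
  have "(\<lambda>\<eta>. complex_of_real (\<eta> $ j)) \<in> ?S" for j
  proof (cases j)
    case (Inl i)
    obtain I where I: "I \<subseteq> K" "\<And>v. complex_of_real (v $ i) = (\<Sum>k\<in>I. z k v)"
      using coord by blast
    have "complex_of_real (\<eta> $ j) = (\<Sum>k\<in>I. z' (Inl k) \<eta>)" for \<eta>
      using I(2)[of "?pr \<eta>"] by (simp add: Inl z'_def)
    moreover have "z' (Inl k) \<in> ?S" if "k \<in> I" for k
      using that I(1) by (intro z'_span) (auto simp: K'_def)
    ultimately show ?thesis by (simp add: complex_span_sum)
  next
    case (Inr b)
    have span: "z' (Inr c) \<in> ?S" for c by (intro z'_span) (auto simp: K'_def)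
    \<comment> \<open>The half sum of the null forms is x, their half difference y.\<close>
    have "(\<lambda>\<eta>. (1 / 2) * z' (Inr True) \<eta> + (if b = 1 then 1 / 2 else - 1 / 2) * z' (Inr False) \<eta>) \<in> ?S"
      by (intro complex_span.add complex_span_scale span)
    also have "(\<lambda>\<eta>. (1 / 2) * z' (Inr True) \<eta> + (if b = 1 then 1 / 2 else - 1 / 2) * z' (Inr False) \<eta>)
        = (\<lambda>\<eta>. complex_of_real (\<eta> $ j))"
      using exhaust_2[of b] by (auto simp: Inr z'_def fun_eq_iff field_simps)
    finally show ?thesis .
  qed
  then have "(\<lambda>\<eta>. complex_of_real (f \<eta>)) \<in> ?S"
    using real_polynomial_in_monomial_span[OF fpoly] by blast
  then have span: "(\<lambda>\<eta>. complex_of_real (f \<eta>)) \<in> complex_span (monomial K' z' ` {a. weight K' \<mu>' a = 1})"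
    by (rule invariant_in_span_of_weight_one[where T = "(*v) ?L", rotated]) (simp_all add: ev finv)
  have weight_one: "parts_in C (monomial K' z' a)" if weight: "weight K' \<mu>' a = 1" for a
  proof -
    define n where "n = a (Inr True)"
    have weight_K': "weight K' \<mu>' a = weight K \<mu> (a \<circ> Inl) * of_real (exp \<beta> ^ n * exp (- \<beta>) ^ a (Inr False))"
      by (simp add: weight_def K'_def prod.Plus K UNIV_bool \<mu>'_def n_def o_def)
    have norm_1: "norm (weight K \<mu> (a \<circ> Inl)) = 1"
      by (simp add: weight_def norm_power z(2) flip: prod_norm)
    \<comment> \<open>Absolute values remove the contribution of \<open>R\<close>, whose eigenvalues
      have modulus one.\<close>
    have "exp \<beta> ^ n * exp (- \<beta>) ^ a (Inr False) = 1"
      using arg_cong[OF weight, of norm]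
      unfolding weight_K' norm_mult norm_1 norm_of_real by (simp add: abs_mult)
    then have "exp (\<beta> * (real n - real (a (Inr False)))) = 1"
      by (simp add: exp_of_nat_mult[symmetric] exp_add[symmetric] algebra_simps)
    \<comment> \<open>A real exponential equals 1 only at 0, so \<open>\<beta> \<noteq> 0\<close>
      forces equal exponents of the two null forms.\<close>
    then have n: "a (Inr False) = n" using \<beta> by simp
    \<comment> \<open>With equal exponents the exponentials cancel, so the \<open>R\<close>-part has
      weight one on its own.\<close>
    have "weight K \<mu> (a \<circ> Inl) = 1"
      using weight unfolding weight_K' n by (simp add: exp_minus flip: power_mult_distrib)
    then have "parts_in (invariant_polynomials (generate orthogonal_group {R})) (monomial K z (a \<circ> Inl))"
      using weight_one_monomial_invariant[OF R K] z by blast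
    then have "parts_in C (\<lambda>\<eta>. monomial K z (a \<circ> Inl) (?pr \<eta>))"
      using C_R[of "\<lambda>v. Re (monomial K z (a \<circ> Inl) v)"] C_R[of "\<lambda>v. Im (monomial K z (a \<circ> Inl) v)"]
      by (simp add: parts_in_def)
    moreover have "parts_in C (\<lambda>\<eta>. complex_of_real ((\<eta> $ Inr 1)\<^sup>2 - (\<eta> $ Inr 2)\<^sup>2))"
      using C_q C by (simp add: parts_in_def real_subalgebra_def)
    ultimately have "parts_in C (\<lambda>\<eta>. monomial K z (a \<circ> Inl) (?pr \<eta>)
        * complex_of_real ((\<eta> $ Inr 1)\<^sup>2 - (\<eta> $ Inr 2)\<^sup>2) ^ n)"
      by (intro parts_in_mult parts_in_power C)
    also have "(\<lambda>\<eta>. monomial K z (a \<circ> Inl) (?pr \<eta>)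
        * complex_of_real ((\<eta> $ Inr 1)\<^sup>2 - (\<eta> $ Inr 2)\<^sup>2) ^ n) = monomial K' z' a"
    proof
      fix \<eta> :: "real ^ ('m + 2)"
      have "(\<eta> $ Inr 1)\<^sup>2 - (\<eta> $ Inr 2)\<^sup>2 = (\<eta> $ Inr 1 + \<eta> $ Inr 2) * (\<eta> $ Inr 1 - \<eta> $ Inr 2)"
        by (simp add: power2_eq_square algebra_simps)
      then show "monomial K z (a \<circ> Inl) (?pr \<eta>)
          * complex_of_real ((\<eta> $ Inr 1)\<^sup>2 - (\<eta> $ Inr 2)\<^sup>2) ^ n = monomial K' z' a \<eta>"
        by (simp only: of_real_mult power_mult_distrib)
          (simp add: monomial_def K'_def prod.Plus K UNIV_bool z'_def n flip: n_def)
    qed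
    finally show ?thesis .
  qed
  have "parts_in C (\<lambda>\<eta>. complex_of_real (f \<eta>))"
    by (rule parts_in_complex_span[OF C _ span]) (auto intro: weight_one)
  then show ?thesis by (simp add: parts_in_def)
qed

section \<open>Transport to the original coordinates\<close>

theorem theoremA:
  fixes R :: "real ^ 'm ^ 'm::finite"
    and \<beta> :: real
    and A P :: "real ^ ('m + 2) ^ ('m + 2)"
    and \<Gamma> :: "(real ^ ('m + 2) ^ ('m + 2)) set"
  assumes "R \<in> carrier orthogonal_group"
    and "\<beta> \<noteq> 0"
    and "subgroup \<Gamma> lorentz_group"
    and "discrete \<Gamma>"
    and "A \<in> carrier lorentz_group"
    and "\<Gamma> = generate lorentz_group {A}"
    and "P \<in> carrier lorentz_group"
    and "P ** A ** matrix_inv P = block_diag R (hyperbolic_rotation \<beta>)"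
  shows "(\<exists>U. hilbert_basis U (invariant_polynomials (generate orthogonal_group {R}))) \<and>
    (\<forall>U. hilbert_basis U (invariant_polynomials (generate orthogonal_group {R})) \<longrightarrow>
      hilbert_basis
        ((\<lambda>u \<xi>. u (\<chi> i. (P *v \<xi>) $ Inl i)) ` U \<union>
         {\<lambda>\<xi>. ((P *v \<xi>) $ Inr 1)\<^sup>2 - ((P *v \<xi>) $ Inr 2)\<^sup>2})
        (invariant_polynomials \<Gamma>))"
proof (intro conjI allI impI)
  note R = assms(1) and A = assms(5)
  let ?L = "block_diag R (hyperbolic_rotation \<beta>)"
  let ?I = "invariant_polynomials (generate orthogonal_group {R})"
  let ?q = "\<lambda>\<eta> :: real ^ ('m + 2). (\<eta> $ Inr 1)\<^sup>2 - (\<eta> $ Inr 2)\<^sup>2"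
  show "\<exists>U. hilbert_basis U ?I" by (rule hilbert_basis_orthogonal_exists[OF R])
  fix U assume "hilbert_basis U ?I"
  then have U: "finite U" "U \<subseteq> ?I" "subalgebra_generated U = ?I"
    by (auto simp: hilbert_basis_def)
  let ?B = "(\<lambda>u \<xi>. u (\<chi> i. (P *v \<xi>) $ Inl i)) ` U \<union> {\<lambda>\<xi>. ?q (P *v \<xi>)}"
  have \<Gamma>: "invariant_polynomials \<Gamma> = {f. real_polynomial_function f \<and> (\<forall>v. f (A *v v) = f v)}"
    unfolding assms(6) by (rule invariant_polynomials_lorentz[OF A])
  have "invertible P" using assms(7) by (simp add: lorentz_group_def)
  \<comment> \<open>\<open>matrix_inv\<close> is a choice of inverse; invertibility turns the choice
    into two equations.\<close>
  then have P: "P ** matrix_inv P = mat 1" "matrix_inv P ** P = mat 1"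
    unfolding invertible_def matrix_inv_def by (metis (mono_tags, lifting) someI_ex)+
  \<comment> \<open>\<open>P\<close> intertwines \<open>A\<close> with the block matrix. This and
    its inverse form \<open>AP\<close> carry invariance between the two coordinate systems.\<close>
  have PA: "P *v (A *v \<xi>) = ?L *v (P *v \<xi>)" for \<xi>
    unfolding assms(8)[symmetric] using P
    by (simp add: matrix_vector_mul_assoc matrix_mul_assoc[symmetric])
  have AP: "A *v (matrix_inv P *v \<eta>) = matrix_inv P *v (?L *v \<eta>)" for \<eta>
    unfolding assms(8)[symmetric] using P
    by (simp add: matrix_vector_mul_assoc matrix_mul_assoc)
  have poly_P: "polynomial_function ((*v) M)" for M :: "real ^ ('m + 2) ^ ('m + 2)"
    by (simp add: polynomial_function_bounded_linear matrix_vector_mul_bounded_linear)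
  have coord: "real_polynomial_function (\<lambda>\<xi>. (P *v \<xi>) $ j)" for j
    by (intro real_polynomial_function.intros(1) bounded_linear_compose[OF bounded_linear_vec_nth]
        matrix_vector_mul_bounded_linear)
  have B: "?B \<subseteq> invariant_polynomials \<Gamma>"
  proof
    fix f assume "f \<in> ?B"
    then consider u where "u \<in> U" "f = (\<lambda>\<xi>. u (\<chi> i. (P *v \<xi>) $ Inl i))" | "f = (\<lambda>\<xi>. ?q (P *v \<xi>))"
      by auto
    then show "f \<in> invariant_polynomials \<Gamma>"
    proof cases
      case 1
      then have u: "real_polynomial_function u" "\<And>v. u (R *v v) = u v"
        using U(2) by (auto simp: invariant_polynomials_orthogonal[OF R])
      have "bounded_linear (\<lambda>\<xi>. (\<chi> i. (P *v \<xi>) $ Inl i) :: real ^ 'm)"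
        unfolding linear_conv_bounded_linear[symmetric]
        by (simp add: linear_iff vec_eq_iff matrix_vector_right_distrib matrix_vector_mult_scaleR)
      then have "real_polynomial_function (u \<circ> (\<lambda>\<xi>. \<chi> i. (P *v \<xi>) $ Inl i))"
        using u(1) by (intro real_polynomial_function_compose polynomial_function_bounded_linear)
      then show ?thesis
        by (simp add: \<Gamma> 1(2) o_def PA block_diag_hyperbolic u(2))
    next
      case 2
      have "?q (?L *v \<eta>) = ?q \<eta>" for \<eta>
      proof -
        \<comment> \<open>In factored form the invariance is visible: one null form is scaled by
          \<open>exp \<beta>\<close>, the other by its reciprocal.\<close>
        have q: "?q \<zeta> = (\<zeta> $ Inr 1 + \<zeta> $ Inr 2) * (\<zeta> $ Inr 1 - \<zeta> $ Inr 2)" for \<zeta>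
          by (simp add: power2_eq_square algebra_simps)
        show ?thesis unfolding q block_diag_hyperbolic by (simp add: exp_minus)
      qed
      moreover have "real_polynomial_function f"
        unfolding 2 by (intro real_polynomial_function_diff real_polynomial_function_power coord)
      ultimately show ?thesis by (simp add: \<Gamma> 2 PA)
    qed
  qed
  have "f \<in> subalgebra_generated ?B" if "f \<in> invariant_polynomials \<Gamma>" for f
  proof -
    \<comment> \<open>Functions of the new coordinates that land in the generated algebra once
      \<open>P *v \<xi>\<close> is substituted; they form the algebra to which
      \<open>block_invariants_subset\<close> is applied.\<close>
    let ?C = "{g. (\<lambda>\<xi>. g (P *v \<xi>)) \<in> subalgebra_generated ?B}"
    have f: "real_polynomial_function f" "\<And>v. f (A *v v) = f v" using that by (auto simp: \<Gamma>)
    have C: "real_subalgebra ?C"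
      by (auto simp: real_subalgebra_def intro: subalgebra_generated.intros)
    have "(\<lambda>\<eta>. f (matrix_inv P *v \<eta>)) \<in> ?C"
    proof (rule block_invariants_subset[OF R assms(2) _ _ C])
      show "real_polynomial_function (\<lambda>\<eta>. f (matrix_inv P *v \<eta>))"
        using real_polynomial_function_compose[OF poly_P f(1)] by (simp add: o_def)
      show "f (matrix_inv P *v (?L *v \<eta>)) = f (matrix_inv P *v \<eta>)" for \<eta>
        by (simp add: AP[symmetric] f(2))
      show "?q \<in> ?C" by (auto intro: subalgebra_generated.base)
      show "(\<lambda>\<eta>. g (\<chi> i. \<eta> $ Inl i)) \<in> ?C" if "g \<in> ?I" for g
      proof -
        have "g \<in> subalgebra_generated U" using that U(3) by simp
        then have "(\<lambda>\<xi>. g (\<chi> i. (P *v \<xi>) $ Inl i)) \<in> subalgebra_generated ?B"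
          by (rule subalgebra_generated_compose[OF _ _ real_subalgebra_generated])
            (auto intro: subalgebra_generated.base)
        then show ?thesis by simp
      qed
    qed
    \<comment> \<open>Substituting \<open>P *v \<xi>\<close> for \<eta> cancels
      \<open>matrix_inv P\<close> and returns \<open>f\<close>.\<close>
    then show ?thesis using P by (simp add: matrix_vector_mul_assoc)
  qed
  moreover have "subalgebra_generated ?B \<subseteq> invariant_polynomials \<Gamma>"
    by (rule subalgebra_generated_least[OF real_subalgebra_invariants B])
  ultimately show "hilbert_basis ?B (invariant_polynomials \<Gamma>)"
    using U(1) B by (auto simp: hilbert_basis_def)
qed

end
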